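(* Let $q$ be a power of a prime, let $m$ be a positive integer, and let $N \mid q^m-1$ be such that every prime divisor of $N$ divides $(q^m-1)/(q-1)$. Then for every subfield $\mathbb{F}_t$ of $\mathbb{F}_q$ and every $c_t \in \mathbb{F}_t^*$, we have $$\Delta_0(N) = Z_{t,\, m[\mathbb{F}_q:\mathbb{F}_t],\, N}(0) - Z_{t,\, m[\mathbb{F}_q:\mathbb{F}_t],\, N}(c_t).$$ Furthermore, if $t \neq q$, then $$\Delta_0(N) = \frac{q\, Z_{q, m, N}(0) - t\, Z_{t,\, m[\mathbb{F}_q:\mathbb{F}_t],\, N}(0)}{q - t}.$$
   Context: $\mu$ is the Möbius function and divisors are positive. For a prime power $u$, a positive integer $k$ and a positive divisor $N$ of $u^k-1$, a non-zero element $\xi \in \mathbb{F}_{u^k}^*$ is called $N$-free if, for any $d \mid N$, $\xi = \gamma^d$ with $\gamma \in \mathbb{F}_{u^k}$ implies $d=1$; equivalently $\xi = \alpha^i$ for some integer $i$ coprime to $N$, where $\alpha$ is a primitive element of $\mathbb{F}_{u^k}$. For $c \in \mathbb{F}_u$, $Z_{u,k,N}(c)$ denotes the number of $N$-free elements $\xi \in \mathbb{F}_{u^k}^*$ with $\operatorname{Tr}_{\mathbb{F}_{u^k}/\mathbb{F}_u}(\xi) = c$. (Note $t^{m[\mathbb{F}_q:\mathbb{F}_t]} = q^m$.) Let $p$ be the characteristic of $\mathbb{F}_q$, $\alpha$ a primitive element of $\mathbb{F}_{q^m}$, and $\chi_{q^m}(z) = e^{2\pi\sqrt{-1}\operatorname{Tr}_{\mathbb{F}_{q^m}/\mathbb{F}_p}(z)/p}$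 the canonical additive character of $\mathbb{F}_{q^m}$. For $d \mid q^m-1$, $\eta_0^{(d,q^m)} = \sum_{x \in \langle \alpha^d\rangle} \chi_{q^m}(x)$ is the $0$-th Gaussian period of type $(d,q^m)$, and $\Delta_0(N) = \sum_{d \mid N} \mu(d)\, \eta_0^{(d,q^m)}$. *)

theory Defs
  imports Complex_Main "HOL-Algebra.Algebra" "HOL-Computational_Algebra.Squarefree"
begin

hide_const (open) Divisibility.prime

definition moebius_mu :: "nat \<Rightarrow> int" where
  "moebius_mu n = (if squarefree n then (- 1) ^ card (prime_factors n) else 0)"

text \<open>
  In the definitions below \<open>L\<close> is a finite field with \<open>u ^ k\<close> elements, where \<open>u\<close> is the
  order of a subfield, so that the conjugates of \<open>x\<close> over that subfield are \<open>x\<close> raised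
  to the powers \<open>u ^ i\<close> for \<open>i < k\<close>.
\<close>

definition field_trace :: "('a, 'b) ring_scheme \<Rightarrow> nat \<Rightarrow> nat \<Rightarrow> 'a \<Rightarrow> 'a" where
  "field_trace L u k x = (\<Oplus>\<^bsub>L\<^esub>i\<in>{..<k}. x [^]\<^bsub>L\<^esub> (u ^ i))"

definition free_elem :: "('a, 'b) ring_scheme \<Rightarrow> nat \<Rightarrow> 'a \<Rightarrow> bool" where
  "free_elem L N \<xi> \<longleftrightarrow> \<xi> \<in> carrier L - {\<zero>\<^bsub>L\<^esub>} \<and>
     (\<forall>d. d dvd N \<longrightarrow> (\<forall>\<gamma>\<in>carrier L. \<xi> = \<gamma> [^]\<^bsub>L\<^esub> d \<longrightarrow> d = 1))"

definition Z_count :: "('a, 'b) ring_scheme \<Rightarrow> nat \<Rightarrow> nat \<Rightarrow> nat \<Rightarrow> 'a \<Rightarrow> nat" where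
  "Z_count L u k N c = card {\<xi>. free_elem L N \<xi> \<and> field_trace L u k \<xi> = c}"

definition primitive_elem :: "('a, 'b) ring_scheme \<Rightarrow> 'a \<Rightarrow> bool" where
  "primitive_elem L \<alpha> \<longleftrightarrow> \<alpha> \<in> carrier (mult_of L) \<and>
     generate (mult_of L) {\<alpha>} = carrier (mult_of L)"

text \<open>
  For \<open>y\<close> in the prime field, \<open>prime_field_rep L y\<close> is its representative in \<open>{0..<p}\<close>,
  where \<open>p\<close> is the characteristic.
\<close>

definition prime_field_rep :: "('a, 'b) ring_scheme \<Rightarrow> 'a \<Rightarrow> nat" where
  "prime_field_rep L y = (LEAST n. [n] \<cdot>\<^bsub>L\<^esub> \<one>\<^bsub>L\<^esub> = y)"

text \<open>
  In the next three definitions \<open>p\<close> is the characteristic of \<open>L\<close> and \<open>L\<close> has \<open>p ^ k\<close> elements.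
\<close>

definition canonical_char :: "('a, 'b) ring_scheme \<Rightarrow> nat \<Rightarrow> nat \<Rightarrow> 'a \<Rightarrow> complex" where
  "canonical_char L p k z =
     exp (2 * of_real pi * \<i> * of_nat (prime_field_rep L (field_trace L p k z)) / of_nat p)"

definition gauss_period0 :: "('a, 'b) ring_scheme \<Rightarrow> nat \<Rightarrow> nat \<Rightarrow> 'a \<Rightarrow> nat \<Rightarrow> complex" where
  "gauss_period0 L p k \<alpha> d =
     (\<Sum>x\<in>generate (mult_of L) {\<alpha> [^]\<^bsub>L\<^esub> d}. canonical_char L p k x)"

definition Delta0 :: "('a, 'b) ring_scheme \<Rightarrow> nat \<Rightarrow> nat \<Rightarrow> 'a \<Rightarrow> nat \<Rightarrow> complex" where
  "Delta0 L p k \<alpha> N =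
     (\<Sum>d | d dvd N. of_int (moebius_mu d) * gauss_period0 L p k \<alpha> d)"

end

theory Submission
  imports Defs
begin

text \<open>
  Let \<open>W\<close> be the set of \<open>N\<close>-free elements of the field \<open>L\<close> with \<open>q ^ m\<close> elements and \<open>\<chi>\<close> its
  canonical additive character. Moebius inversion over the subgroups generated by the powers \<open>\<alpha> ^ d\<close>
  shows that \<open>\<Delta>\<close> is the sum of \<open>\<chi>\<close> over \<open>W\<close> (\<open>Delta0_eq_sum_free\<close>).

  The assumption on the prime divisors of \<open>N\<close> makes \<open>W\<close> stable under multiplication by the non-zero
  elements of \<open>F\<close> (\<open>free_elem_mult_iff\<close>), since these are \<open>r\<close>-th powers for every prime \<open>r\<close>
  dividing \<open>N\<close>. Let \<open>K\<close> be a subfield of \<open>F\<close> with \<open>u\<close> elements, and write \<open>Z(c)\<close> for the number of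
  elements of \<open>W\<close> with trace \<open>c\<close> in \<open>K\<close>. As the trace is \<open>K\<close>-linear, stability implies that \<open>Z(c)\<close>
  is the same for all non-zero \<open>c\<close> (\<open>trace_fibre_card_eq\<close>). By transitivity of the trace, \<open>\<chi>\<close> is the
  canonical character \<open>\<psi>\<close> of \<open>K\<close> composed with the trace to \<open>K\<close>, and the values of \<open>\<psi>\<close> on \<open>K\<close> add
  up to zero. Grouping the sum over \<open>W\<close> by the value of the trace yields \<open>\<Delta> = Z(0) - Z(c)\<close>
  (\<open>sum_canonical_char_trace_fibres\<close>).

  The same grouping counts \<open>W\<close>: \<open>card W = Z(0) + (u - 1) Z(c) = u Z(0) - (u - 1) \<Delta>\<close>. Comparing this
  for the two fields \<open>F\<close> and \<open>K\<close> gives the second formula.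
\<close>

section \<open>Arithmetic preliminaries\<close>

text \<open>
  Only squarefree divisors contribute, and these are the products of the subsets of the set
  \<open>P\<close> of prime factors; so the sum is the expansion of the product of the factors
  \<open>1 - 1\<close>, one for each prime in \<open>P\<close>, and vanishes unless \<open>P\<close> is empty.
\<close>

lemma sum_moebius_mu_divisors:
  assumes "n > 0"
  shows "(\<Sum>d | d dvd n. moebius_mu d) = (if n = 1 then 1 else 0)"
proof -
  let ?P = "prime_factors n"
  have fin: "finite {d. d dvd n}" using assms by simp
  have pf: "prime_factors (\<Prod>S) = S" if "S \<subseteq> ?P" for S
  proof -
    have "finite S" using that finite_subset by blast
    have "prime_factorization (\<Prod>\<^sub># (mset_set S)) = mset_set S"
      using that \<open>finite S\<close> by (intro prime_factorization_prod_mset_primes) auto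
    then have "prime_factorization (\<Prod>S) = mset_set S"
      by (simp add: prod_unfold_prod_mset)
    then show ?thesis using \<open>finite S\<close> by simp
  qed
  have sqf: "squarefree (\<Prod>S)" if "S \<subseteq> ?P" for S
    using that by (intro squarefree_prod_coprime)
       (auto intro!: primes_coprime squarefree_prime)
  have bij: "bij_betw (\<lambda>S. \<Prod>S) (Pow ?P) {d. d dvd n \<and> squarefree d}"
  proof (rule bij_betw_byWitness[where f' = prime_factors])
    show "\<forall>S\<in>Pow ?P. prime_factors (\<Prod>S) = S" using pf by blast
    show "\<forall>d\<in>{d. d dvd n \<and> squarefree d}. \<Prod>(prime_factors d) = d"
    proof safe
      fix d assume d: "d dvd n" "squarefree d"
      then have "d \<noteq> 0" using assms by auto
      then have "d = (\<Prod>r\<in>prime_factors d. r ^ multiplicity r d)"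
        by (simp add: prime_factorization_nat)
      also have "\<dots> = (\<Prod>r\<in>prime_factors d. r)"
        using d(2) squarefree_factorial_semiring'[OF \<open>d \<noteq> 0\<close>] by (intro prod.cong) auto
      finally show "\<Prod>(prime_factors d) = d" by simp
    qed
    show "(\<lambda>S. \<Prod>S) ` Pow ?P \<subseteq> {d. d dvd n \<and> squarefree d}"
    proof safe
      fix S assume S: "S \<subseteq> ?P"
      show "squarefree (\<Prod>S)" by (rule sqf[OF S])
      have "\<Prod>S dvd \<Prod>?P" using S by (intro prod_dvd_prod_subset) auto
      also have "\<dots> dvd (\<Prod>r\<in>?P. r ^ multiplicity r n)"
        by (intro prod_dvd_prod) (auto intro!: dvd_power simp: prime_factors_multiplicity)
      also have "\<dots> = n" by (rule prime_factorization_nat[OF assms, symmetric])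
      finally show "\<Prod>S dvd n" .
    qed
    show "prime_factors ` {d. d dvd n \<and> squarefree d} \<subseteq> Pow ?P"
      using assms dvd_prime_factors by auto
  qed
  have "(\<Sum>d | d dvd n. moebius_mu d) = (\<Sum>d | d dvd n \<and> squarefree d. moebius_mu d)"
    using fin by (intro sum.mono_neutral_right) (auto simp: moebius_mu_def)
  also have "\<dots> = (\<Sum>S\<in>Pow ?P. moebius_mu (\<Prod>S))"
    by (rule sum.reindex_bij_betw[OF bij, symmetric])
  also have "\<dots> = (\<Sum>S\<in>Pow ?P. (\<Prod>r\<in>S. - 1) * (\<Prod>r\<in>?P - S. 1))"
    by (intro sum.cong) (auto simp: moebius_mu_def pf sqf)
  also have "\<dots> = (\<Prod>r\<in>?P. - 1 + 1 :: int)"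
    by (rule prod_add[symmetric]) simp
  also have "\<dots> = (if n = 1 then 1 else 0)"
    using assms by (auto simp: prime_factorization_empty_iff power_0_left card_eq_0_iff)
  finally show ?thesis .
qed

lemma coprime_nat_iff_no_common_prime:
  "coprime (a::nat) b \<longleftrightarrow> (\<forall>r. prime r \<longrightarrow> r dvd a \<longrightarrow> \<not> r dvd b)"
proof
  assume no: "\<forall>r. prime r \<longrightarrow> r dvd a \<longrightarrow> \<not> r dvd b"
  show "coprime a b"
  proof (rule ccontr)
    assume "\<not> coprime a b"
    then have "gcd a b \<noteq> 1" by (simp add: coprime_iff_gcd_eq_1)
    then obtain r where "prime r" "r dvd gcd a b" using prime_factor_nat by blast
    moreover from this have "r dvd a" "r dvd b" by auto
    ultimately show False using no by blast
  qed
next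
  assume "coprime a b"
  then show "\<forall>r. prime r \<longrightarrow> r dvd a \<longrightarrow> \<not> r dvd b"
    using coprime_common_divisor[of a b] not_prime_unit by blast
qed

section \<open>Commutative algebra preliminaries\<close>

text \<open>
  Each step of a flag of subspaces multiplies the number of elements by \<open>card K\<close>: if
  \<open>v \<notin> E\<close>, an element of \<open>K v + E\<close> has only one expression as \<open>k v + w\<close>, since two
  expressions with different \<open>k\<close> could be solved for \<open>v\<close> inside \<open>E\<close>.
\<close>

lemma (in ring) card_dimension:
  assumes "dimension d K E" and "subfield K R" and "finite K"
  shows "finite E \<and> card E = card K ^ d"
  using assms
proof (induction rule: dimension.induct)
  case (zero_dim K)
  then show ?case by simp
next
  case (Suc_dim v E d K)
  have K: "K \<subseteq> carrier R" using subfieldE(3)[OF Suc_dim.prems(1)] .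
  have alg: "subalgebra K E R"
    using finite_dimension_imp_subalgebra[OF Suc_dim.prems(1)] finite_dimensionI Suc_dim.hyps(3)
    by blast
  have E: "E \<subseteq> carrier R" by (rule subalgebra_in_carrier[OF alg])
  interpret E: subgroup E "add_monoid R" by (rule subalgebra.axioms(1)[OF alg])
  let ?f = "\<lambda>(k, w). k \<otimes> v \<oplus> w"
  have "inj_on ?f (K \<times> E)"
  proof (rule inj_onI, clarify)
    fix k w k' w'
    assume kw: "k \<in> K" "w \<in> E" "k' \<in> K" "w' \<in> E" and eq: "k \<otimes> v \<oplus> w = k' \<otimes> v \<oplus> w'"
    have car: "k \<in> carrier R" "k' \<in> carrier R" "w \<in> carrier R" "w' \<in> carrier R" "v \<in> carrier R"
      using kw K E Suc_dim.hyps(1) by auto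
    have diff: "(k \<ominus> k') \<otimes> v = w' \<ominus> w"
    proof -
      have "(k \<ominus> k') \<otimes> v = (k \<otimes> v \<oplus> w) \<ominus> w \<ominus> k' \<otimes> v" using car by algebra
      also have "\<dots> = w' \<ominus> w" unfolding eq using car by algebra
      finally show ?thesis .
    qed
    have "w' \<ominus> w \<in> E"
      using kw(2,4) E.m_closed E.m_inv_closed by (simp add: a_minus_def a_inv_def)
    have "k = k'"
    proof (rule ccontr)
      assume "k \<noteq> k'"
      then have nz: "k \<ominus> k' \<in> K - {\<zero>}"
        using kw car subringE(5,7)[OF subfieldE(1)[OF Suc_dim.prems(1)]]
        by (auto simp: a_minus_def) (metis a_minus_def r_right_minus_eq)
      have inv: "inv (k \<ominus> k') \<in> K" "inv (k \<ominus> k') \<otimes> (k \<ominus> k') = \<one>"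
        using subfield_m_inv[OF Suc_dim.prems(1) nz] by auto
      have "inv (k \<ominus> k') \<otimes> (w' \<ominus> w) \<in> E"
        using subalgebra.smult_closed[OF alg inv(1) \<open>w' \<ominus> w \<in> E\<close>] .
      also have "inv (k \<ominus> k') \<otimes> (w' \<ominus> w) = v"
        unfolding diff[symmetric] using inv K car
        by (subst m_assoc[symmetric]) (auto simp: a_minus_def)
      finally show False using Suc_dim.hyps(2) by simp
    qed
    then show "k = k' \<and> w = w'" using eq car by simp
  qed
  moreover have "line_extension K v E = ?f ` (K \<times> E)"
    by (auto simp: line_extension_mem_iff image_iff) blast
  ultimately show ?case using Suc_dim by (simp add: card_image card_cartesian_product)
qed

lemma (in ring) finite_subfield_dim:
  assumes "subfield K R" "subfield F R" "K \<subseteq> F" "finite F"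
  shows "card F = card K ^ dim K F"
proof -
  obtain Us where Us: "set Us = F" using finite_list[OF \<open>finite F\<close>] by blast
  have F: "F \<subseteq> carrier R" "subring F R" using assms(2) by (auto simp: subfieldE)
  have "subalgebra K F R"
    unfolding subalgebra_def subalgebra_axioms_def
    using F(2) assms(3) subringE(6)[OF F(2)] subring.axioms(1) by blast
  then have "Span K Us = F"
    using Span_base_incl[OF assms(1), of Us] subalgebra_Span_incl[OF assms(1), of F Us] F(1) Us by auto
  then have "finite_dimension K F"
    using Span_finite_dimension[OF assms(1), of Us] F(1) Us by simp
  then have "dimension (dim K F) K F"
    using finite_dimensionE[OF assms(1)] by (simp add: over_def)
  then show ?thesis
    using card_dimension[OF _ assms(1)] finite_subset[OF assms(3,4)] by blast
qed

text \<open>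
  Induction on \<open>n\<close>; with \<open>t n i\<close> the \<open>i\<close>-th summand, Pascal's rule reads
  \<open>t (n + 1) (i + 1) = t n i x + t n (i + 1) y\<close>.
\<close>

lemma (in cring) binomial_theorem:
  fixes n :: nat
  assumes [simp]: "x \<in> carrier R" "y \<in> carrier R"
  shows "(x \<oplus> y) [^] n = (\<Oplus>i\<in>{..n}. [(n choose i)] \<cdot>\<^bsub>R\<^esub> (x [^] i \<otimes> y [^] (n - i)))"
proof (induction n)
  case 0
  then show ?case by simp
next
  case (Suc n)
  define t where "t = (\<lambda>k i. [(k choose i)] \<cdot>\<^bsub>R\<^esub> (x [^] i \<otimes> y [^] (k - i)))"
  have [simp]: "t k i \<in> carrier R" for k i by (simp add: t_def)
  have top: "t n (Suc n) = \<zero>"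
  proof -
    have "n choose Suc n = 0" by simp
    then show ?thesis unfolding t_def by (simp only: add.nat_pow_0)
  qed
  have zero: "t (Suc n) 0 = t n 0 \<otimes> y"
    by (simp add: t_def)
  have step: "t (Suc n) (Suc i) = t n i \<otimes> x \<oplus> t n (Suc i) \<otimes> y" if "i \<le> n" for i
  proof -
    have "x [^] i \<otimes> y [^] (n - i) \<otimes> x = x [^] Suc i \<otimes> y [^] (n - i)"
      by (simp add: m_ac)
    moreover have "[(n choose Suc i)] \<cdot>\<^bsub>R\<^esub> (x [^] Suc i \<otimes> y [^] (n - Suc i) \<otimes> y)
        = [(n choose Suc i)] \<cdot>\<^bsub>R\<^esub> (x [^] Suc i \<otimes> y [^] (n - i))"
    proof (cases "i = n")
      case True
      have "n choose Suc n = 0" by simp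
      then show ?thesis unfolding True by (simp only: add.nat_pow_0)
    next
      case False
      then have "n - i = Suc (n - Suc i)" using that by simp
      then show ?thesis by (simp add: m_assoc)
    qed
    ultimately show ?thesis
      by (simp add: t_def add_pow_ldistr add.nat_pow_mult)
  qed
  have "(x \<oplus> y) [^] Suc n = (\<Oplus>i\<in>{..n}. t n i) \<otimes> (x \<oplus> y)"
    using Suc.IH by (simp add: t_def)
  also have "\<dots> = (\<Oplus>i\<in>{..n}. t n i \<otimes> x) \<oplus> (\<Oplus>i\<in>{..n}. t n i \<otimes> y)"
    by (simp add: r_distr finsum_ldistr)
  also have "(\<Oplus>i\<in>{..n}. t n i \<otimes> y) = (\<Oplus>i\<in>{..Suc n}. t n i \<otimes> y)"
    by (simp add: top)
  also have "\<dots> = (\<Oplus>i\<in>{..n}. t n (Suc i) \<otimes> y) \<oplus> t n 0 \<otimes> y"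
    by (rule finsum_Suc2) simp
  also have "(\<Oplus>i\<in>{..n}. t n i \<otimes> x) \<oplus> \<dots>
      = (\<Oplus>i\<in>{..n}. t n i \<otimes> x \<oplus> t n (Suc i) \<otimes> y) \<oplus> t n 0 \<otimes> y"
    by (simp add: finsum_addf a_assoc)
  also have "(\<Oplus>i\<in>{..n}. t n i \<otimes> x \<oplus> t n (Suc i) \<otimes> y) = (\<Oplus>i\<in>{..n}. t (Suc n) (Suc i))"
    by (intro finsum_cong') (auto simp: step)
  also have "\<dots> \<oplus> t n 0 \<otimes> y = (\<Oplus>i\<in>{..Suc n}. t (Suc n) i)"
    unfolding zero[symmetric] by (rule finsum_Suc2[symmetric]) simp
  finally show ?case by (simp add: t_def)
qed

section \<open>Finite fields and the Frobenius map\<close>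

locale finite_field = field R for R (structure) +
  fixes p n :: nat
  assumes finite_carrier: "finite (carrier R)"
    and prime_p: "prime p"
    and card_carrier: "card (carrier R) = p ^ n"
begin

lemma pow_eq_zeroD:
  assumes "x [^] (k::nat) = \<zero>" and "x \<in> carrier R"
  shows "x = \<zero>"
  using assms
proof (induction k)
  case (Suc k)
  then show ?case using integral[of "x [^] k" x] by auto
qed simp

lemma group_mult_of: "group (mult_of R)"
  using field_mult_group by (simp add: mult_of_def Multiplicative_Group.mult_of_def)

lemma order_mult_of_eq: "order (mult_of R) = p ^ n - 1"
  using finite_carrier card_carrier by (simp add: order_def card_Diff_singleton)

lemma pow_card_eq:
  assumes "x \<in> carrier R"
  shows "x [^] (p ^ n) = x"
proof (cases "x = \<zero>")
  case True
  then show ?thesis using prime_gt_0_nat[OF prime_p] by (simp add: nat_pow_zero)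
next
  case False
  interpret M: group "mult_of R" by (rule group_mult_of)
  have "x [^]\<^bsub>mult_of R\<^esub> order (mult_of R) = \<one>\<^bsub>mult_of R\<^esub>"
    using False assms by (intro M.pow_order_eq_1) simp
  then have "x [^] (p ^ n - 1) = \<one>"
    by (simp add: order_mult_of_eq nat_pow_mult_of)
  then have "x [^] Suc (p ^ n - 1) = x" using assms by simp
  then show ?thesis using prime_gt_0_nat[OF prime_p] by simp
qed

lemma add_pow_one_mult: "[(a * b)] \<cdot>\<^bsub>R\<^esub> \<one> = [a] \<cdot>\<^bsub>R\<^esub> \<one> \<otimes> [b] \<cdot>\<^bsub>R\<^esub> \<one>" for a b :: nat
  by (simp add: add_pow_ldistr add.nat_pow_pow mult.commute)

text \<open>
  The order \<open>p ^ n\<close> of the additive group annihilates \<open>1\<close>, and the image of \<open>p ^ n\<close> in the field is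
  the \<open>n\<close>-th power of the image of \<open>p\<close>.
\<close>

lemma p_one_eq_zero: "[p] \<cdot>\<^bsub>R\<^esub> \<one> = \<zero>"
proof -
  have pow: "[(p ^ k)] \<cdot>\<^bsub>R\<^esub> \<one> = ([p] \<cdot>\<^bsub>R\<^esub> \<one>) [^] k" for k :: nat
    by (induction k) (simp_all add: add_pow_one_mult m_comm)
  have "[(order (add_monoid R))] \<cdot>\<^bsub>R\<^esub> \<one> = \<zero>"
    using add.pow_order_eq_1[of \<one>] by (simp add: add_pow_def)
  then have "([p] \<cdot>\<^bsub>R\<^esub> \<one>) [^] n = \<zero>"
    by (simp add: order_def card_carrier pow[symmetric])
  then show ?thesis
    by (rule pow_eq_zeroD) simp
qed

lemma p_dvd_imp_add_pow_eq_zero: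
  assumes "p dvd k" and "x \<in> carrier R"
  shows "[(k::nat)] \<cdot>\<^bsub>R\<^esub> x = \<zero>"
proof -
  obtain j where "k = p * j" using assms(1) by blast
  then have "[k] \<cdot>\<^bsub>R\<^esub> \<one> = \<zero>" by (simp add: add_pow_one_mult p_one_eq_zero)
  moreover have "[k] \<cdot>\<^bsub>R\<^esub> x = [k] \<cdot>\<^bsub>R\<^esub> \<one> \<otimes> x" using assms(2) by (simp add: add_pow_ldistr)
  ultimately show ?thesis using assms(2) by simp
qed

lemma add_pow_one_eq_iff: "[a] \<cdot>\<^bsub>R\<^esub> \<one> = [b] \<cdot>\<^bsub>R\<^esub> \<one> \<longleftrightarrow> a mod p = b mod p" for a b :: nat
proof -
  have ord: "[k] \<cdot>\<^bsub>R\<^esub> \<one> = \<zero> \<longleftrightarrow> add.ord \<one> dvd k" for k :: nat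
    using add.pow_eq_id[of \<one> k] by (simp add: add_pow_def)
  have "add.ord \<one> dvd p" using ord p_one_eq_zero by blast
  moreover have "add.ord \<one> \<noteq> 1" using ord[of 1] by auto
  ultimately have "add.ord \<one> = p" using prime_p by (auto simp: prime_nat_iff)
  then have zero_iff: "[k] \<cdot>\<^bsub>R\<^esub> \<one> = \<zero> \<longleftrightarrow> p dvd k" for k :: nat using ord by simp
  have le: "[a] \<cdot>\<^bsub>R\<^esub> \<one> = [b] \<cdot>\<^bsub>R\<^esub> \<one> \<longleftrightarrow> a mod p = b mod p" if "a \<le> b" for a b :: nat
  proof -
    have "[b] \<cdot>\<^bsub>R\<^esub> \<one> = [a] \<cdot>\<^bsub>R\<^esub> \<one> \<oplus> [(b - a)] \<cdot>\<^bsub>R\<^esub> \<one>"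
      using that by (simp add: add.nat_pow_mult)
    then have "[a] \<cdot>\<^bsub>R\<^esub> \<one> = [b] \<cdot>\<^bsub>R\<^esub> \<one> \<longleftrightarrow> [(b - a)] \<cdot>\<^bsub>R\<^esub> \<one> = \<zero>"
      by simp
    then show ?thesis
      using that zero_iff[of "b - a"] mod_eq_dvd_iff_nat[OF that, of p] by auto
  qed
  show ?thesis using le[of a b] le[of b a] by (cases a b rule: le_cases) auto
qed

text \<open>
  For exponent \<open>p\<close>, every inner binomial coefficient is divisible by the characteristic; higher powers
  of \<open>p\<close> follow by iteration.
\<close>

lemma frobenius_add:
  assumes [simp]: "x \<in> carrier R" "y \<in> carrier R"
  shows "(x \<oplus> y) [^] (p ^ k) = x [^] (p ^ k) \<oplus> y [^] (p ^ k)"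
proof (induction k)
  case (Suc k)
  have base: "(a \<oplus> b) [^] p = a [^] p \<oplus> b [^] p"
    if [simp]: "a \<in> carrier R" "b \<in> carrier R" for a b
  proof -
    define t where "t = (\<lambda>i. [(p choose i)] \<cdot>\<^bsub>R\<^esub> (a [^] i \<otimes> b [^] (p - i)))"
    have [simp]: "t i \<in> carrier R" for i by (simp add: t_def)
    obtain r where p: "p = Suc r" using prime_gt_0_nat[OF prime_p] by (cases p) auto
    obtain s where r: "r = Suc s" using prime_gt_1_nat[OF prime_p] p by (cases r) auto
    have t0: "t (Suc i) = \<zero>" if "i \<le> s" for i
    proof -
      have "p dvd (p choose Suc i)"
      proof (rule dvd_choose_prime)
        show "Suc i < p" using that unfolding p r by simp
        show "p \<noteq> 0" unfolding p by simp
      qed (use prime_p in simp_all)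
      then show ?thesis unfolding t_def by (rule p_dvd_imp_add_pow_eq_zero) simp
    qed
    have "(a \<oplus> b) [^] p = (\<Oplus>i\<in>{..Suc (Suc s)}. t i)"
      using binomial_theorem[of a b p] p r by (simp add: t_def)
    also have "\<dots> = t p \<oplus> (\<Oplus>i\<in>{..Suc s}. t i)"
      using p r by (simp add: finsum_Suc)
    also have "(\<Oplus>i\<in>{..Suc s}. t i) = (\<Oplus>i\<in>{..s}. t (Suc i)) \<oplus> t 0"
      by (rule finsum_Suc2) simp
    also have "(\<Oplus>i\<in>{..s}. t (Suc i)) = (\<Oplus>i\<in>{..s}. \<zero>)"
      by (intro finsum_cong') (auto simp: t0)
    finally show ?thesis by (simp add: t_def)
  qed
  have "(x \<oplus> y) [^] (p ^ Suc k) = ((x \<oplus> y) [^] (p ^ k)) [^] p"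
    by (simp add: nat_pow_pow mult.commute)
  then show ?case by (simp add: Suc.IH base nat_pow_pow mult.commute)
qed simp

lemma frobenius_finsum:
  assumes "finite I" and "f \<in> I \<rightarrow> carrier R"
  shows "(\<Oplus>i\<in>I. f i) [^] (p ^ k) = (\<Oplus>i\<in>I. f i [^] (p ^ k))"
  using assms
proof (induction I)
  case empty
  then show ?case using prime_gt_0_nat[OF prime_p] by (simp add: nat_pow_zero)
next
  case (insert i I)
  then show ?case by (simp add: frobenius_add Pi_iff finsum_closed)
qed

section \<open>Subfields as fixed point sets\<close>

text \<open>
  The equation \<open>x ^ (u - 1) = 1\<close> has at most \<open>u - 1\<close> solutions, so a set of \<open>u\<close> fixed points
  that contains \<open>0\<close> is already the set of all of them. This identifies both the subfields (for
  \<open>u\<close> their order) and the multiples of \<open>1\<close> (for \<open>u = p\<close>).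
\<close>

lemma fixed_points_eq:
  assumes "A \<subseteq> carrier R" and "\<zero> \<in> A" and "card A = u" and "u > 1"
    and fixed: "\<And>x. x \<in> A \<Longrightarrow> x [^] u = x"
  shows "A = {x \<in> carrier R. x [^] u = x}"
proof -
  let ?U = "{x \<in> carrier R. x [^] (u - 1) = \<one>}"
  have iff: "x [^] u = x \<longleftrightarrow> x [^] (u - 1) = \<one>" if x: "x \<in> carrier R" "x \<noteq> \<zero>" for x
  proof -
    have "x [^] u = x [^] (u - 1) \<otimes> x"
      using \<open>u > 1\<close> nat_pow_Suc[of x "u - 1"] by simp
    then show ?thesis using x by (metis l_one m_rcancel nat_pow_closed one_closed)
  qed
  have "A - {\<zero>} \<subseteq> ?U"
  proof
    fix x assume "x \<in> A - {\<zero>}"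
    then show "x \<in> ?U" using assms(1) fixed[of x] iff[of x] by auto
  qed
  moreover have "finite ?U" using finite_carrier by simp
  moreover have "card ?U \<le> card (A - {\<zero>})"
    using num_roots_le_deg[OF finite_carrier, of "u - 1"] assms(2,3,4)
    by (simp add: card_Diff_singleton)
  ultimately have U: "A - {\<zero>} = ?U" by (intro card_seteq)
  have "\<zero> [^] u = \<zero>" using fixed assms(2) by blast
  then have "{x \<in> carrier R. x [^] u = x} - {\<zero>} = ?U"
  proof -
    have zero: "\<zero> \<notin> ?U" using \<open>u > 1\<close> by (simp add: nat_pow_zero)
    have "x \<in> {x \<in> carrier R. x [^] u = x} - {\<zero>} \<longleftrightarrow> x \<in> ?U" for x
      using iff[of x] zero by (cases "x = \<zero>") auto
    then show ?thesis by (rule Set.set_eqI)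
  qed
  with U have "insert \<zero> (A - {\<zero>}) = insert \<zero> ({x \<in> carrier R. x [^] u = x} - {\<zero>})"
    by (simp only:)
  then show ?thesis using assms(2) \<open>\<zero> [^] u = \<zero>\<close> by (simp add: insert_absorb)
qed

lemma subfield_eq_fixed_points:
  assumes K: "subfield K R"
  shows "K = {x \<in> carrier R. x [^] card K = x}"
proof (rule fixed_points_eq)
  show sub: "K \<subseteq> carrier R" and "\<zero> \<in> K"
    using subfieldE(3)[OF K] subringE(2)[OF subfieldE(1)[OF K]] by auto
  have "finite K" using sub finite_carrier finite_subset by blast
  moreover have "{\<zero>, \<one>} \<subseteq> K" using subringE(2,3)[OF subfieldE(1)[OF K]] by auto
  ultimately show "card K > 1"
    using card_mono[of K "{\<zero>, \<one>}"] by simp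
  interpret KF: field "R\<lparr>carrier := K\<rparr>" by (rule subfield_iff(2)[OF K])
  interpret M: group "mult_of (R\<lparr>carrier := K\<rparr>)"
    using KF.field_mult_group by (simp add: mult_of_def Multiplicative_Group.mult_of_def)
  fix x assume x: "x \<in> K"
  show "x [^] card K = x"
  proof (cases "x = \<zero>")
    case True
    then show ?thesis using \<open>card K > 1\<close> by (simp add: nat_pow_zero)
  next
    case False
    have pow: "x [^]\<^bsub>mult_of (R\<lparr>carrier := K\<rparr>)\<^esub> (k::nat) = x [^] k" for k
      by (induction k) simp_all
    have "x [^]\<^bsub>mult_of (R\<lparr>carrier := K\<rparr>)\<^esub> order (mult_of (R\<lparr>carrier := K\<rparr>)) = \<one>"
      using M.pow_order_eq_1[of x] x False by simp
    then have "x [^] (card K - 1) = \<one>"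
      unfolding pow using \<open>finite K\<close> \<open>\<zero> \<in> K\<close> by (simp add: order_def card_Diff_singleton)
    then have "x [^] Suc (card K - 1) = x" using x sub by auto
    then show ?thesis using \<open>card K > 1\<close> by simp
  qed
qed simp

corollary subfield_mem_iff:
  assumes "subfield K R"
  shows "x \<in> K \<longleftrightarrow> x \<in> carrier R \<and> x [^] card K = x"
  using arg_cong[OF subfield_eq_fixed_points[OF assms], of "\<lambda>A. x \<in> A"] by simp

lemma add_pow_one_frobenius: "([(k::nat)] \<cdot>\<^bsub>R\<^esub> \<one>) [^] p = [k] \<cdot>\<^bsub>R\<^esub> \<one>"
proof (induction k)
  case 0
  then show ?case using prime_gt_0_nat[OF prime_p] by (simp add: nat_pow_zero)
next
  case (Suc k)
  then show ?case using frobenius_add[of "[k] \<cdot>\<^bsub>R\<^esub> \<one>" \<one> 1] by simp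
qed

lemma frobenius_fixed_imp_prime_field:
  assumes "y \<in> carrier R" and "y [^] p = y"
  obtains k :: nat where "y = [k] \<cdot>\<^bsub>R\<^esub> \<one>"
proof -
  let ?A = "(\<lambda>k. [(k::nat)] \<cdot>\<^bsub>R\<^esub> \<one>) ` {..<p}"
  have "inj_on (\<lambda>k. [(k::nat)] \<cdot>\<^bsub>R\<^esub> \<one>) {..<p}"
    by (rule inj_onI) (simp add: add_pow_one_eq_iff)
  then have "card ?A = p" by (simp add: card_image)
  moreover have "\<zero> \<in> ?A"
    using prime_gt_0_nat[OF prime_p] by (intro image_eqI[of _ _ 0]) auto
  moreover have "?A \<subseteq> carrier R" by (rule image_subsetI) simp
  moreover have "x [^] p = x" if "x \<in> ?A" for x
    using that by (elim imageE) (simp only: add_pow_one_frobenius)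
  ultimately have "?A = {x \<in> carrier R. x [^] p = x}"
    using prime_gt_1_nat[OF prime_p] by (intro fixed_points_eq)
  then have "y \<in> ?A" using assms by simp
  then show ?thesis by (elim imageE) (rule that)
qed

text \<open>
  The representative turns addition in the prime field into addition modulo \<open>p\<close>, which makes the
  canonical character a homomorphism.
\<close>

lemma prime_field_rep_add_pow_one: "prime_field_rep R ([(k::nat)] \<cdot>\<^bsub>R\<^esub> \<one>) = k mod p"
  unfolding prime_field_rep_def
proof (rule Least_equality)
  show "[(k mod p)] \<cdot>\<^bsub>R\<^esub> \<one> = [k] \<cdot>\<^bsub>R\<^esub> \<one>" by (simp add: add_pow_one_eq_iff)
next
  fix j :: nat
  assume "[j] \<cdot>\<^bsub>R\<^esub> \<one> = [k] \<cdot>\<^bsub>R\<^esub> \<one>"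
  then have "k mod p = j mod p" by (simp add: add_pow_one_eq_iff)
  then show "k mod p \<le> j" by simp
qed

section \<open>Traces\<close>

lemma field_trace_closed [simp]:
  "x \<in> carrier R \<Longrightarrow> field_trace R u k x \<in> carrier R"
  by (simp add: field_trace_def finsum_closed)

lemma field_trace_0: "field_trace R u 0 x = \<zero>"
  by (simp add: field_trace_def)

lemma field_trace_Suc:
  assumes "x \<in> carrier R"
  shows "field_trace R u (Suc k) x = field_trace R u k x \<oplus> x [^] (u ^ k)"
  using assms by (simp add: field_trace_def lessThan_Suc a_comm finsum_closed)

lemma field_trace_append:
  assumes "x \<in> carrier R"
  shows "field_trace R u (a + b) x = field_trace R u a x \<oplus> field_trace R u b (x [^] (u ^ a))"
proof (induction b)
  case 0
  then show ?case using assms by (simp add: field_trace_0)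
next
  case (Suc b)
  have "x [^] (u ^ (a + b)) = (x [^] (u ^ a)) [^] (u ^ b)"
    using assms by (simp add: nat_pow_pow power_add)
  then show ?case using assms Suc by (simp add: field_trace_Suc a_assoc)
qed

lemma field_trace_add:
  assumes "x \<in> carrier R" and "y \<in> carrier R"
  shows "field_trace R (p ^ s) k (x \<oplus> y) = field_trace R (p ^ s) k x \<oplus> field_trace R (p ^ s) k y"
proof -
  have "(x \<oplus> y) [^] ((p ^ s) ^ i) = x [^] ((p ^ s) ^ i) \<oplus> y [^] ((p ^ s) ^ i)" for i
    using frobenius_add[OF assms, of "s * i"] by (simp add: power_mult)
  then show ?thesis using assms by (simp add: field_trace_def finsum_addf)
qed

lemma field_trace_smult:
  assumes "c \<in> carrier R" and "x \<in> carrier R" and "c [^] u = c"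
  shows "field_trace R u k (c \<otimes> x) = c \<otimes> field_trace R u k x"
proof -
  have "c [^] (u ^ i) = c" for i
    using assms by (induction i) (simp_all add: nat_pow_pow[symmetric])
  then show ?thesis
    using assms(1,2) by (simp add: field_trace_def nat_pow_distrib finsum_rdistr)
qed

text \<open>
  Raising to the power \<open>u = p ^ s\<close> only permutes the conjugates cyclically; by the fixed point
  description of subfields, the trace to a subfield with \<open>u\<close> elements thus takes its values there.
\<close>

lemma field_trace_fixed:
  assumes x: "x \<in> carrier R" and fixed: "x [^] ((p ^ s) ^ k) = x"
  shows "field_trace R (p ^ s) k x [^] (p ^ s) = field_trace R (p ^ s) k x"
proof -
  let ?u = "p ^ s"
  have "field_trace R ?u k x [^] ?u = (\<Oplus>i\<in>{..<k}. (x [^] (?u ^ i)) [^] ?u)"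
    using x by (simp add: field_trace_def frobenius_finsum)
  also have "\<dots> = field_trace R ?u k (x [^] ?u)"
    using x by (simp add: field_trace_def nat_pow_pow mult.commute)
  finally have pow: "field_trace R ?u k x [^] ?u = field_trace R ?u k (x [^] ?u)" .
  have "x \<oplus> field_trace R ?u k (x [^] ?u) = field_trace R ?u (1 + k) x"
    using x field_trace_append[OF x, of ?u 1 k] by (simp add: field_trace_Suc field_trace_0)
  also have "\<dots> = x \<oplus> field_trace R ?u k x"
    using x fixed by (simp add: field_trace_Suc a_comm)
  finally show ?thesis using pow x by simp
qed

text \<open>
  Transitivity of the trace: the \<open>s k\<close> conjugates fall into \<open>k\<close> consecutive blocks of length \<open>s\<close>,
  the \<open>j\<close>-th of which sums to the value of the \<open>s\<close>-term trace at \<open>x ^ (p ^ (s j))\<close>; additivity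
  collects these values.
\<close>

lemma field_trace_trans:
  assumes x: "x \<in> carrier R"
  shows "field_trace R p (s * k) x = field_trace R p s (field_trace R (p ^ s) k x)"
proof (induction k)
  case 0
  have "field_trace R p s \<zero> = \<zero>"
    using field_trace_smult[of \<zero> \<zero> p s] prime_gt_0_nat[OF prime_p] by (simp add: nat_pow_zero)
  then show ?case by (simp add: field_trace_0)
next
  case (Suc k)
  have "field_trace R p (s * Suc k) x
      = field_trace R p (s * k) x \<oplus> field_trace R p s (x [^] ((p ^ s) ^ k))"
    using field_trace_append[OF x, of p "s * k" s] by (simp add: power_mult add.commute)
  also have "\<dots> = field_trace R p s (field_trace R (p ^ s) (Suc k) x)"
    using field_trace_add[of "field_trace R (p ^ s) k x" "x [^] ((p ^ s) ^ k)" 1 s] x Suc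
    by (simp add: field_trace_Suc)
  finally show ?case .
qed

text \<open>
  As a function of \<open>x\<close> the trace is a polynomial of degree smaller than the number of elements of the
  field on which it is considered; this is what forces it to be non-zero somewhere.
\<close>

lemma trace_polynomial:
  "\<exists>f\<in>carrier (UP R). deg R f = p ^ s \<and>
     (\<forall>x\<in>carrier R. UnivPoly.eval R R id x f = field_trace R p (Suc s) x)"
proof -
  interpret U: UP_domain R "UP R" by unfold_locales
  show ?thesis
  proof (induction s)
    case 0
    show ?case
    proof (rule bexI[of _ "up_ring.monom (UP R) \<one> 1"], intro conjI ballI)
      fix x assume "x \<in> carrier R"
      then show "UnivPoly.eval R R id x (up_ring.monom (UP R) \<one> 1) = field_trace R p (Suc 0) x"
        by (subst U.evalRR_monom) (simp_all add: field_trace_Suc field_trace_0)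
    qed simp_all
  next
    case (Suc s)
    then obtain f where f: "f \<in> carrier (UP R)" "deg R f = p ^ s"
      "\<And>x. x \<in> carrier R \<Longrightarrow> UnivPoly.eval R R id x f = field_trace R p (Suc s) x" by blast
    let ?g = "f \<oplus>\<^bsub>UP R\<^esub> up_ring.monom (UP R) \<one> (p ^ Suc s)"
    have "p ^ s < p ^ Suc s" using prime_gt_1_nat[OF prime_p] by simp
    then have "deg R ?g = p ^ Suc s"
      using f by (subst U.deg_add_eq) auto
    moreover have "UnivPoly.eval R R id x ?g = field_trace R p (Suc (Suc s)) x" if "x \<in> carrier R" for x
      using that f by (simp add: U.evalRR_add U.evalRR_monom field_trace_Suc[of x p "Suc s"])
    moreover have "?g \<in> carrier (UP R)" using f(1) by simp
    ultimately show ?case by blast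
  qed
qed

lemma field_trace_nonzero:
  assumes "K \<subseteq> carrier R" and "card K = p ^ s" and "s > 0"
  shows "\<exists>x\<in>K. field_trace R p s x \<noteq> \<zero>"
proof (rule ccontr)
  assume "\<not> ?thesis"
  then have zero: "\<And>x. x \<in> K \<Longrightarrow> field_trace R p s x = \<zero>" by blast
  interpret U: UP_domain R "UP R" by unfold_locales
  obtain r where s: "s = Suc r" using assms(3) by (cases s) auto
  obtain f where f: "f \<in> carrier (UP R)" "deg R f = p ^ r"
    "\<And>x. x \<in> carrier R \<Longrightarrow> UnivPoly.eval R R id x f = field_trace R p s x"
    using trace_polynomial[of r] unfolding s by blast
  have "f \<noteq> \<zero>\<^bsub>UP R\<^esub>"
    using f(2) prime_gt_0_nat[OF prime_p] U.deg_nzero_nzero by simp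
  then have "card {a \<in> carrier R. UnivPoly.eval R R id a f = \<zero>} \<le> p ^ r"
    using U.roots_bound[OF f(1) _ finite_carrier] f(2) by simp
  moreover have "card K \<le> card {a \<in> carrier R. UnivPoly.eval R R id a f = \<zero>}"
    using assms(1) zero f(3) finite_carrier by (intro card_mono) auto
  moreover have "p ^ r < p ^ s" unfolding s using prime_gt_1_nat[OF prime_p] by simp
  ultimately show False using assms(2) by simp
qed

section \<open>The canonical additive character\<close>

lemma canonical_char_eq_cis:
  assumes "field_trace R p k z = [(j::nat)] \<cdot>\<^bsub>R\<^esub> \<one>"
  shows "canonical_char R p k z = cis (2 * pi * real j / real p)"
proof -
  have p: "real p > 0" using prime_gt_0_nat[OF prime_p] by simp
  have "real j = real (j mod p) + real (j div p) * real p"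
    by (metis div_mult_mod_eq of_nat_add of_nat_mult add.commute)
  then have "2 * pi * real j / real p = 2 * pi * real (j mod p) / real p + 2 * pi * real (j div p)"
    using p by (simp add: field_simps)
  then have "cis (2 * pi * real j / real p)
      = cis (2 * pi * real (j mod p) / real p) * cis (2 * pi * real (j div p))"
    by (simp only: cis_mult)
  also have "cis (2 * pi * real (j div p)) = 1"
    by (rule cis_multiple_2pi) simp
  also have "cis (2 * pi * real (j mod p) / real p) * 1 = canonical_char R p k z"
    unfolding canonical_char_def assms prime_field_rep_add_pow_one cis_conv_exp
    by (simp add: mult_ac)
  finally show ?thesis ..
qed

lemma field_trace_in_prime_field:
  assumes "x \<in> carrier R" and "x [^] (p ^ k) = x"
  obtains j :: nat where "field_trace R p k x = [j] \<cdot>\<^bsub>R\<^esub> \<one>"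
  using frobenius_fixed_imp_prime_field[of "field_trace R p k x"]
    field_trace_fixed[of x 1 k] assms by auto

text \<open>
  For \<open>x\<close> and \<open>y\<close> in the field with \<open>p ^ k\<close> elements, the traces are multiples of \<open>1\<close>, and the
  representatives of these add up modulo \<open>p\<close>.
\<close>

lemma canonical_char_add:
  assumes x: "x \<in> carrier R" "x [^] (p ^ k) = x" and y: "y \<in> carrier R" "y [^] (p ^ k) = y"
  shows "canonical_char R p k (x \<oplus> y) = canonical_char R p k x * canonical_char R p k y"
proof -
  obtain i j :: nat where
    i: "field_trace R p k x = [i] \<cdot>\<^bsub>R\<^esub> \<one>" and j: "field_trace R p k y = [j] \<cdot>\<^bsub>R\<^esub> \<one>"
    using field_trace_in_prime_field x y by metis
  have "field_trace R p k (x \<oplus> y) = [(i + j)] \<cdot>\<^bsub>R\<^esub> \<one>"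
    using field_trace_add[OF x(1) y(1), of 1 k] i j by (simp add: add.nat_pow_mult)
  then show ?thesis
    using i j by (simp add: canonical_char_eq_cis cis_mult add_divide_distrib ring_distribs)
qed

lemma canonical_char_zero: "canonical_char R p k \<zero> = 1"
proof -
  have "field_trace R p k \<zero> = \<zero>"
    using field_trace_smult[of \<zero> \<zero> p k] prime_gt_0_nat[OF prime_p] by (simp add: nat_pow_zero)
  then show ?thesis using canonical_char_eq_cis[of k \<zero> 0] by simp
qed

lemma canonical_char_eq_1_imp:
  assumes "x \<in> carrier R" "x [^] (p ^ k) = x" and "canonical_char R p k x = 1"
  shows "field_trace R p k x = \<zero>"
proof -
  obtain j :: nat where j: "field_trace R p k x = [j] \<cdot>\<^bsub>R\<^esub> \<one>"
    using field_trace_in_prime_field assms(1,2) by metis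
  then have j': "field_trace R p k x = [(j mod p)] \<cdot>\<^bsub>R\<^esub> \<one>"
    by (simp add: add_pow_one_eq_iff)
  have p: "p > 0" by (rule prime_gt_0_nat[OF prime_p])
  have "cis (2 * pi * real (j mod p) / real p) = cis (2 * pi * real 0 / real p)"
    using canonical_char_eq_cis[OF j'] assms(3) by simp
  then have "j mod p = 0"
    using bij_betw_imp_inj_on[OF bij_betw_roots_unity[OF p]] p
    by (intro inj_onD[of "\<lambda>k. cis (2 * pi * real k / real p)" "{..<p}"]) auto
  then show ?thesis using j' by simp
qed

text \<open>
  Orthogonality: translation by an element on which the character differs from \<open>1\<close> multiplies the sum
  by that value. Such an element exists because the trace from \<open>K\<close> to the prime field is not zero.
\<close>

lemma sum_canonical_char_subfield:
  assumes K: "subfield K R" and card: "card K = p ^ s" and "s > 0"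
  shows "(\<Sum>c\<in>K. canonical_char R p s c) = 0"
proof -
  have sub: "K \<subseteq> carrier R" by (rule subfieldE(3)[OF K])
  have fixed: "x [^] (p ^ s) = x" if "x \<in> K" for x
    using subfield_mem_iff[OF K] that card by simp
  obtain b where b: "b \<in> K" "field_trace R p s b \<noteq> \<zero>"
    using field_trace_nonzero[OF sub card \<open>s > 0\<close>] by blast
  then have nontriv: "canonical_char R p s b \<noteq> 1"
    using canonical_char_eq_1_imp fixed sub by blast
  note ops = subringE(5,7)[OF subfieldE(1)[OF K]]
  have "bij_betw (\<lambda>c. b \<oplus> c) K K"
  proof (rule bij_betw_byWitness[where f' = "\<lambda>c. \<ominus> b \<oplus> c"])
    show "\<forall>c\<in>K. \<ominus> b \<oplus> (b \<oplus> c) = c" and "\<forall>c\<in>K. b \<oplus> (\<ominus> b \<oplus> c) = c"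
      using b sub by (auto simp: r_neg1 r_neg2 subset_iff)
  qed (use b ops in auto)
  then have "(\<Sum>c\<in>K. canonical_char R p s c) = (\<Sum>c\<in>K. canonical_char R p s (b \<oplus> c))"
    by (rule sum.reindex_bij_betw[symmetric])
  also have "\<dots> = canonical_char R p s b * (\<Sum>c\<in>K. canonical_char R p s c)"
    unfolding sum_distrib_left using b sub fixed by (intro sum.cong canonical_char_add) auto
  finally show ?thesis using nontriv by simp
qed

end

section \<open>Powers of a primitive element\<close>

locale finite_field_generator = finite_field +
  fixes \<alpha>
  assumes primitive: "primitive_elem R \<alpha>"
begin

lemma generator_closed [simp]: "\<alpha> \<in> carrier R" and generator_nonzero: "\<alpha> \<noteq> \<zero>"
  using primitive by (auto simp: primitive_elem_def)

lemma generator_pow_nonzero: "\<alpha> [^] (i::nat) \<noteq> \<zero>"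
  using pow_eq_zeroD generator_nonzero by auto

lemma nonzero_eq_generator_pow:
  assumes "x \<in> carrier R" and "x \<noteq> \<zero>"
  obtains i :: nat where "x = \<alpha> [^] i"
proof -
  interpret M: group "mult_of R" by (rule group_mult_of)
  have "finite (carrier (mult_of R))" using finite_carrier by simp
  then have "carrier (mult_of R) = {\<alpha> [^]\<^bsub>mult_of R\<^esub> k |k. k \<in> (UNIV :: nat set)}"
    using primitive M.generate_pow_on_finite_carrier[of \<alpha>] by (simp add: primitive_elem_def)
  then show ?thesis using assms that by (auto simp: nat_pow_mult_of)
qed

lemma generator_pow_eq_one_iff: "\<alpha> [^] (i::nat) = \<one> \<longleftrightarrow> (p ^ n - 1) dvd i"
proof -
  interpret M: group "mult_of R" by (rule group_mult_of)
  have \<alpha>: "\<alpha> \<in> carrier (mult_of R)" using primitive by (simp add: primitive_elem_def)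
  have "M.ord \<alpha> = order (mult_of R)"
    using M.generate_pow_card[OF \<alpha>] primitive by (simp add: primitive_elem_def order_def)
  then show ?thesis
    using M.pow_eq_id[OF \<alpha>, of i] by (simp add: nat_pow_mult_of order_mult_of_eq)
qed

lemma order_pos: "p ^ n - 1 > 0"
proof -
  have "{\<zero>, \<one>} \<subseteq> carrier R" by simp
  then have "card {\<zero>, \<one>} \<le> p ^ n"
    using card_mono[OF finite_carrier] card_carrier by metis
  then show ?thesis by simp
qed

lemma generator_pow_eq_iff:
  "\<alpha> [^] (i::nat) = \<alpha> [^] (j::nat) \<longleftrightarrow> i mod (p ^ n - 1) = j mod (p ^ n - 1)"
proof -
  have le: "\<alpha> [^] i = \<alpha> [^] j \<longleftrightarrow> i mod (p ^ n - 1) = j mod (p ^ n - 1)" if "i \<le> j" for i j :: nat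
  proof -
    have "\<alpha> [^] j = \<alpha> [^] (j - i) \<otimes> \<alpha> [^] i" using that by (simp add: nat_pow_mult)
    then have "\<alpha> [^] j = \<alpha> [^] i \<longleftrightarrow> \<alpha> [^] (j - i) \<otimes> \<alpha> [^] i = \<one> \<otimes> \<alpha> [^] i" by simp
    also have "\<dots> \<longleftrightarrow> \<alpha> [^] (j - i) = \<one>"
      using generator_pow_nonzero[of i] by (intro m_rcancel) simp_all
    also have "\<dots> \<longleftrightarrow> j mod (p ^ n - 1) = i mod (p ^ n - 1)"
      by (simp only: generator_pow_eq_one_iff mod_eq_dvd_iff_nat[OF that])
    finally show ?thesis by (simp only: eq_commute[of "\<alpha> [^] i"] eq_commute[of "i mod (p ^ n - 1)"])
  qed
  show ?thesis using le[of i j] le[of j i] by (cases i j rule: le_cases) auto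
qed

lemma generator_pow_is_power_iff:
  assumes d: "d dvd p ^ n - 1"
  shows "(\<exists>\<gamma>\<in>carrier R. \<alpha> [^] (i::nat) = \<gamma> [^] d) \<longleftrightarrow> d dvd i"
proof
  assume "d dvd i"
  then obtain k where "i = d * k" by (rule dvdE)
  then have "\<alpha> [^] i = (\<alpha> [^] k) [^] d" by (simp add: nat_pow_pow mult.commute)
  then show "\<exists>\<gamma>\<in>carrier R. \<alpha> [^] i = \<gamma> [^] d" by (intro bexI[of _ "\<alpha> [^] k"]) auto
next
  assume "\<exists>\<gamma>\<in>carrier R. \<alpha> [^] i = \<gamma> [^] d"
  then obtain \<gamma> where \<gamma>: "\<gamma> \<in> carrier R" "\<alpha> [^] i = \<gamma> [^] d" by blast
  have "d > 0" using dvd_pos_nat[OF order_pos d] .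
  have "\<gamma> \<noteq> \<zero>"
  proof
    assume "\<gamma> = \<zero>"
    then have "\<alpha> [^] i = \<zero>" using \<gamma>(2) \<open>d > 0\<close> by (simp add: nat_pow_zero)
    then show False using generator_pow_nonzero by simp
  qed
  with \<gamma>(1) obtain k :: nat where "\<gamma> = \<alpha> [^] k" by (rule nonzero_eq_generator_pow)
  then have "i mod (p ^ n - 1) = (k * d) mod (p ^ n - 1)"
    using \<gamma>(2) by (simp add: nat_pow_pow generator_pow_eq_iff)
  then have "i mod d = (k * d) mod d"
    using mod_mod_cancel[OF d, of i] mod_mod_cancel[OF d, of "k * d"] by simp
  then show "d dvd i" by (simp add: dvd_eq_mod_eq_0)
qed

lemma mem_generate_generator_pow_iff:
  assumes d: "d dvd p ^ n - 1"
  shows "\<alpha> [^] (i::nat) \<in> generate (mult_of R) {\<alpha> [^] d} \<longleftrightarrow> d dvd i"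
proof -
  interpret M: group "mult_of R" by (rule group_mult_of)
  have "finite (carrier (mult_of R))" using finite_carrier by simp
  then have gen: "generate (mult_of R) {\<alpha> [^] d} = {\<alpha> [^] (d * k) |k. k \<in> (UNIV :: nat set)}"
    using M.generate_pow_on_finite_carrier[of "\<alpha> [^] d"] generator_pow_nonzero
    by (simp add: nat_pow_mult_of nat_pow_pow)
  show ?thesis
  proof
    assume "d dvd i"
    then show "\<alpha> [^] i \<in> generate (mult_of R) {\<alpha> [^] d}" unfolding gen by blast
  next
    assume "\<alpha> [^] i \<in> generate (mult_of R) {\<alpha> [^] d}"
    then obtain k where "\<alpha> [^] i = \<alpha> [^] (d * k)" unfolding gen by blast
    then have "\<alpha> [^] i = (\<alpha> [^] k) [^] d" by (simp add: nat_pow_pow mult.commute)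
    then have "\<exists>\<gamma>\<in>carrier R. \<alpha> [^] i = \<gamma> [^] d"
      by (intro bexI[of _ "\<alpha> [^] k"]) simp_all
    then show "d dvd i" by (simp only: generator_pow_is_power_iff[OF d])
  qed
qed

text \<open>
  Being free becomes a condition on the discrete logarithm, since for \<open>d\<close> dividing the group order
  the \<open>d\<close>-th powers are exactly the powers of \<open>\<alpha>\<close> with exponent divisible by \<open>d\<close>.
\<close>

lemma free_elem_generator_pow_iff:
  assumes N: "N dvd p ^ n - 1"
  shows "free_elem R N (\<alpha> [^] (i::nat)) \<longleftrightarrow> coprime N i"
proof -
  have "free_elem R N (\<alpha> [^] i) \<longleftrightarrow>
      (\<forall>d. d dvd N \<longrightarrow> (\<exists>\<gamma>\<in>carrier R. \<alpha> [^] i = \<gamma> [^] d) \<longrightarrow> d = 1)"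
    using generator_pow_nonzero by (auto simp: free_elem_def)
  also have "\<dots> \<longleftrightarrow> (\<forall>d. d dvd N \<longrightarrow> d dvd i \<longrightarrow> d = 1)"
    by (simp add: generator_pow_is_power_iff[OF dvd_trans[OF _ N]] cong: imp_cong)
  also have "\<dots> \<longleftrightarrow> coprime N i"
    unfolding coprime_def by auto
  finally show ?thesis .
qed

text \<open>
  This is where the hypothesis on the prime divisors of \<open>N\<close> enters. The exponents of the non-zero
  elements \<open>c\<close> with \<open>c ^ q = c\<close>, as powers of \<open>\<alpha>\<close>, are multiples of \<open>(p ^ n - 1) div (q - 1)\<close>, hence of every prime
  divisor of \<open>N\<close>; adding such an exponent does not affect coprimality with \<open>N\<close>.
\<close>

lemma free_elem_mult_iff:
  assumes N: "N dvd p ^ n - 1"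
    and radical: "\<And>r. prime r \<Longrightarrow> r dvd N \<Longrightarrow> r dvd (p ^ n - 1) div (q - 1)"
    and q: "(q - 1) dvd p ^ n - 1" "q > 1"
    and c: "c \<in> carrier R" "c \<noteq> \<zero>" "c [^] q = c"
    and x: "x \<in> carrier R"
  shows "free_elem R N (c \<otimes> x) \<longleftrightarrow> free_elem R N x"
proof (cases "x = \<zero>")
  case True
  then show ?thesis using c by simp
next
  case False
  obtain i :: nat where i: "c = \<alpha> [^] i" using nonzero_eq_generator_pow c by blast
  obtain j :: nat where j: "x = \<alpha> [^] j" using nonzero_eq_generator_pow x False by blast
  have "\<alpha> [^] (i * q) = \<alpha> [^] i" using c(3) by (simp add: i nat_pow_pow)
  then have "p ^ n - 1 dvd i * q - i"
    using \<open>q > 1\<close> by (simp add: generator_pow_eq_iff mod_eq_dvd_iff_nat)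
  also have "i * q - i = (q - 1) * i" by (simp add: algebra_simps)
  finally have dvd: "p ^ n - 1 dvd (q - 1) * i" .
  have "(p ^ n - 1) div (q - 1) dvd i"
  proof -
    obtain k where k: "p ^ n - 1 = (q - 1) * k" using q(1) by blast
    then show ?thesis using dvd \<open>q > 1\<close> by simp
  qed
  then have primes: "r dvd i" if "prime r" "r dvd N" for r
    using radical[OF that] dvd_trans by blast
  have "coprime N (i + j) \<longleftrightarrow> coprime N j"
  proof -
    have "r dvd i + j \<longleftrightarrow> r dvd j" if "prime r" "r dvd N" for r
      using primes[OF that] by (rule dvd_add_right_iff)
    then show ?thesis unfolding coprime_nat_iff_no_common_prime by blast
  qed
  then show ?thesis
    unfolding i j by (simp add: nat_pow_mult free_elem_generator_pow_iff[OF N])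
qed

text \<open>
  Interchanging the two summations leaves, at \<open>x = \<alpha> ^ i\<close>, the sum of the Moebius function over the
  common divisors of \<open>N\<close> and \<open>i\<close>, which is the indicator of the free elements.
\<close>

lemma Delta0_eq_sum_free:
  assumes N: "N dvd p ^ n - 1"
  shows "Delta0 R p n \<alpha> N = (\<Sum>x | free_elem R N x. canonical_char R p n x)"
proof -
  interpret M: group "mult_of R" by (rule group_mult_of)
  let ?G = "carrier R - {\<zero>}"
  let ?H = "\<lambda>d. generate (mult_of R) {\<alpha> [^] d}"
  let ?\<chi> = "canonical_char R p n"
  have finG: "finite ?G" using finite_carrier by simp
  have "N > 0" using dvd_pos_nat[OF order_pos N] .
  then have finN: "finite {d. d dvd N}" by simp
  have sub: "?H d \<subseteq> ?G" for d :: nat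
    using M.generate_incl[of "{\<alpha> [^] d}"] generator_pow_nonzero by simp
  have moebius: "(\<Sum>d | d dvd N \<and> x \<in> ?H d. moebius_mu d) = (if free_elem R N x then 1 else 0)"
    if x: "x \<in> ?G" for x
  proof -
    obtain i :: nat where i: "x = \<alpha> [^] i" using nonzero_eq_generator_pow x by blast
    have "{d. d dvd N \<and> x \<in> ?H d} = {d. d dvd gcd N i}"
      unfolding i using mem_generate_generator_pow_iff dvd_trans[OF _ N] by auto
    moreover have "gcd N i > 0" using \<open>N > 0\<close> by simp
    ultimately show ?thesis
      using sum_moebius_mu_divisors[of "gcd N i"] free_elem_generator_pow_iff[OF N, of i]
      by (simp add: i coprime_iff_gcd_eq_1)
  qed
  have "Delta0 R p n \<alpha> N = (\<Sum>d | d dvd N. \<Sum>x\<in>?H d. of_int (moebius_mu d) * ?\<chi> x)"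
    by (simp add: Delta0_def gauss_period0_def sum_distrib_left)
  also have "\<dots> = (\<Sum>d | d dvd N. \<Sum>x\<in>{x\<in>?G. x \<in> ?H d}. of_int (moebius_mu d) * ?\<chi> x)"
    using sub by (intro sum.cong) auto
  also have "\<dots> = (\<Sum>x\<in>?G. \<Sum>d\<in>{d\<in>{d. d dvd N}. x \<in> ?H d}. of_int (moebius_mu d) * ?\<chi> x)"
    by (rule sum.swap_restrict[OF finN finG])
  also have "\<dots> = (\<Sum>x\<in>?G. of_int (\<Sum>d | d dvd N \<and> x \<in> ?H d. moebius_mu d) * ?\<chi> x)"
    by (simp add: sum_distrib_right)
  also have "\<dots> = (\<Sum>x\<in>?G. if free_elem R N x then ?\<chi> x else 0)"
    by (intro sum.cong) (simp_all add: moebius del: of_int_sum)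
  also have "\<dots> = (\<Sum>x\<in>{x\<in>?G. free_elem R N x}. ?\<chi> x)"
    by (rule sum.inter_filter[OF finG, symmetric])
  also have "{x\<in>?G. free_elem R N x} = {x. free_elem R N x}"
    by (auto simp: free_elem_def)
  finally show ?thesis .
qed

end

section \<open>Sums over sets stable under a subfield\<close>

context finite_field
begin

lemma finite_subfield:
  assumes "subfield K R"
  shows "finite K"
proof (rule finite_subset)
  show "K \<subseteq> carrier R" by (rule subfieldE(3)[OF assms])
qed (rule finite_carrier)

text \<open>
  Multiplication by \<open>b / a\<close> maps the fibre of the trace over \<open>a\<close> injectively into the fibre over
  \<open>b\<close>, because the trace is \<open>K\<close>-linear.
\<close>

lemma trace_fibre_card_eq:
  assumes K: "subfield K R" and A: "A \<subseteq> carrier R"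
    and scale: "\<forall>c\<in>K - {\<zero>}. \<forall>x\<in>A. c \<otimes> x \<in> A"
    and c: "c \<in> K - {\<zero>}" and c': "c' \<in> K - {\<zero>}"
  shows "card {x \<in> A. field_trace R (card K) k x = c} = card {x \<in> A. field_trace R (card K) k x = c'}"
proof -
  let ?T = "field_trace R (card K) k"
  have le: "card {x \<in> A. ?T x = a} \<le> card {x \<in> A. ?T x = b}"
    if a: "a \<in> K - {\<zero>}" and b: "b \<in> K - {\<zero>}" for a b
  proof (rule card_inj_on_le)
    have sub: "K \<subseteq> carrier R" by (rule subfieldE(3)[OF K])
    have inv: "inv a \<in> K - {\<zero>}" "inv a \<otimes> a = \<one>" using subfield_m_inv[OF K a] by auto
    define e where "e = b \<otimes> inv a"
    have "e \<in> K" using inv b subringE(6)[OF subfieldE(1)[OF K]] by (simp add: e_def)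
    moreover have "e \<noteq> \<zero>" using inv b sub integral[of b "inv a"] by (auto simp: e_def)
    ultimately have e: "e \<in> K - {\<zero>}" by simp
    have ecar: "e \<in> carrier R" using e sub by blast
    have "e [^] card K = e" using e subfield_mem_iff[OF K, of e] by simp
    then have T: "?T (e \<otimes> x) = e \<otimes> ?T x" if "x \<in> carrier R" for x
      using field_trace_smult[OF ecar that] by blast
    have "a \<in> carrier R" "b \<in> carrier R" "inv a \<in> carrier R" using inv a b sub by auto
    then have "e \<otimes> a = b" using inv(2) by (simp add: e_def m_assoc)
    then show "(\<lambda>x. e \<otimes> x) ` {x \<in> A. ?T x = a} \<subseteq> {x \<in> A. ?T x = b}"
      using T e scale A by auto
    show "inj_on (\<lambda>x. e \<otimes> x) {x \<in> A. ?T x = a}"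
    proof (rule inj_onI)
      fix x y assume "x \<in> {x \<in> A. ?T x = a}" "y \<in> {x \<in> A. ?T x = a}" and eq: "e \<otimes> x = e \<otimes> y"
      then have "x \<in> carrier R" "y \<in> carrier R" using A by auto
      then show "x = y" using eq e ecar by (simp add: m_lcancel)
    qed
    show "finite {x \<in> A. ?T x = b}"
      using finite_subset[OF A finite_carrier] by simp
  qed
  show ?thesis using le[OF c c'] le[OF c' c] by simp
qed

text \<open>
  Taking the canonical character for \<open>g\<close> evaluates the character sum over \<open>A\<close>, and taking the constant \<open>1\<close>
  counts \<open>A\<close>.
\<close>

lemma sum_by_trace_fibres:
  assumes K: "subfield K R" and card: "card K = p ^ s" and "s * k = n"
    and A: "A \<subseteq> carrier R"
    and scale: "\<forall>c\<in>K - {\<zero>}. \<forall>x\<in>A. c \<otimes> x \<in> A"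
    and c: "c \<in> K - {\<zero>}"
    and f: "\<And>x. x \<in> A \<Longrightarrow> f x = g (field_trace R (card K) k x)"
  shows "(\<Sum>x\<in>A. f x) =
    of_nat (card {x \<in> A. field_trace R (card K) k x = \<zero>}) * g \<zero> +
    of_nat (card {x \<in> A. field_trace R (card K) k x = c}) * (\<Sum>b\<in>K - {\<zero>}. g b :: complex)"
proof -
  let ?T = "field_trace R (card K) k"
  have finA: "finite A" using finite_subset[OF A finite_carrier] .
  have finK: "finite K" by (rule finite_subfield[OF K])
  have "?T x \<in> K" if "x \<in> A" for x
  proof -
    have x: "x \<in> carrier R" using that A by blast
    then have "x [^] ((p ^ s) ^ k) = x"
      using pow_card_eq by (simp add: power_mult[symmetric] \<open>s * k = n\<close>)
    then have "?T x [^] card K = ?T x" using field_trace_fixed[OF x] card by simp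
    then show ?thesis using x by (simp add: subfield_mem_iff[OF K])
  qed
  then have sub: "?T ` A \<subseteq> K" by blast
  have "(\<Sum>x\<in>A. f x) = (\<Sum>b\<in>K. \<Sum>x\<in>{x\<in>A. ?T x = b}. f x)"
    by (rule sum.group[OF finA finK sub, symmetric])
  also have "\<dots> = (\<Sum>b\<in>K. of_nat (card {x\<in>A. ?T x = b}) * g b)"
  proof (rule sum.cong[OF refl])
    fix b assume "b \<in> K"
    have "(\<Sum>x\<in>{x\<in>A. ?T x = b}. f x) = (\<Sum>x\<in>{x\<in>A. ?T x = b}. g b)"
      by (intro sum.cong) (auto simp: f)
    then show "(\<Sum>x\<in>{x\<in>A. ?T x = b}. f x) = of_nat (card {x\<in>A. ?T x = b}) * g b" by simp
  qed
  also have "\<dots> = of_nat (card {x\<in>A. ?T x = \<zero>}) * g \<zero> +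
      (\<Sum>b\<in>K - {\<zero>}. of_nat (card {x\<in>A. ?T x = b}) * g b)"
    using subringE(2)[OF subfieldE(1)[OF K]] by (intro sum.remove finK)
  also have "(\<Sum>b\<in>K - {\<zero>}. of_nat (card {x\<in>A. ?T x = b}) * g b)
      = (\<Sum>b\<in>K - {\<zero>}. of_nat (card {x\<in>A. ?T x = c}) * g b)"
    using trace_fibre_card_eq[OF K A scale _ c] by (intro sum.cong) simp_all
  finally show ?thesis by (simp add: sum_distrib_left)
qed

text \<open>
  The canonical character of the whole field is that of \<open>K\<close> composed with the trace to \<open>K\<close>. The values
  of the latter character at the non-zero elements of \<open>K\<close> add up to \<open>-1\<close>, and all the fibres over these elements
  have the same size.
\<close>

lemma sum_canonical_char_trace_fibres:
  assumes K: "subfield K R" and card: "card K = p ^ s" and "s > 0" and "s * k = n"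
    and A: "A \<subseteq> carrier R"
    and scale: "\<forall>c\<in>K - {\<zero>}. \<forall>x\<in>A. c \<otimes> x \<in> A"
    and c: "c \<in> K - {\<zero>}"
  shows "(\<Sum>x\<in>A. canonical_char R p n x) =
    of_nat (card {x \<in> A. field_trace R (card K) k x = \<zero>}) -
    of_nat (card {x \<in> A. field_trace R (card K) k x = c})"
proof -
  have finK: "finite K" by (rule finite_subfield[OF K])
  have "canonical_char R p n x = canonical_char R p s (field_trace R (card K) k x)" if "x \<in> A" for x
    using field_trace_trans[of x s k] that A card \<open>s * k = n\<close>
    by (auto simp: canonical_char_def)
  then have "(\<Sum>x\<in>A. canonical_char R p n x) =
    of_nat (card {x \<in> A. field_trace R (card K) k x = \<zero>}) * canonical_char R p s \<zero> +
    of_nat (card {x \<in> A. field_trace R (card K) k x = c}) *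
      (\<Sum>b\<in>K - {\<zero>}. canonical_char R p s b)"
    by (rule sum_by_trace_fibres[OF K card \<open>s * k = n\<close> A scale c,
          where f = "canonical_char R p n" and g = "canonical_char R p s"])
  also have "(\<Sum>b\<in>K - {\<zero>}. canonical_char R p s b) = - 1"
    using sum_canonical_char_subfield[OF K card \<open>s > 0\<close>]
      sum.remove[OF finK subringE(2)[OF subfieldE(1)[OF K]], of "canonical_char R p s"]
    by (simp add: canonical_char_zero eq_neg_iff_add_eq_0 add.commute)
  finally show ?thesis by (simp add: canonical_char_zero)
qed

lemma card_trace_fibres:
  assumes K: "subfield K R" and card: "card K = p ^ s" and "s * k = n"
    and A: "A \<subseteq> carrier R"
    and scale: "\<forall>c\<in>K - {\<zero>}. \<forall>x\<in>A. c \<otimes> x \<in> A"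
    and c: "c \<in> K - {\<zero>}"
  shows "(of_nat (card A) :: complex) =
    of_nat (card {x \<in> A. field_trace R (card K) k x = \<zero>}) +
    of_nat (card {x \<in> A. field_trace R (card K) k x = c}) * (of_nat (card K) - 1)"
proof -
  have finK: "finite K" by (rule finite_subfield[OF K])
  have zero: "\<zero> \<in> K" by (rule subringE(2)[OF subfieldE(1)[OF K]])
  have "card (K - {\<zero>}) = card K - 1" using zero by (simp add: card_Diff_singleton)
  moreover have "card K > 0" using finK zero by (auto simp: card_gt_0_iff)
  ultimately have "(\<Sum>b\<in>K - {\<zero>}. 1) = (of_nat (card K) - 1 :: complex)"
    by (simp add: of_nat_diff)
  then show ?thesis
    using sum_by_trace_fibres[OF K card \<open>s * k = n\<close> A scale c, of "\<lambda>x. 1" "\<lambda>x. 1"] by simp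
qed

end

section \<open>The differences of counts of free elements\<close>

theorem corollary1p13:
  fixes L :: "('a, 'b) ring_scheme"
    and F K :: "'a set"
    and \<alpha> :: 'a
    and p e q m N t :: nat
  assumes "prime p" and "e > 0" and "q = p ^ e" and "m > 0"
    and "field L" and "finite (carrier L)" and "card (carrier L) = q ^ m"
    and "subfield F L" and "card F = q"
    and "primitive_elem L \<alpha>"
    and "N dvd q ^ m - 1"
    and "\<And>r. prime r \<Longrightarrow> r dvd N \<Longrightarrow> r dvd (q ^ m - 1) div (q - 1)"
    and "subfield K L" and "K \<subseteq> F" and "card K = t"
  shows "(\<forall>c\<in>K - {\<zero>\<^bsub>L\<^esub>}.
            Delta0 L p (e * m) \<alpha> N =
              of_nat (Z_count L t (m * ring.dim L K F) N \<zero>\<^bsub>L\<^esub>)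
              - of_nat (Z_count L t (m * ring.dim L K F) N c)) \<and>
         (t \<noteq> q \<longrightarrow>
            Delta0 L p (e * m) \<alpha> N =
              (of_nat q * of_nat (Z_count L q m N \<zero>\<^bsub>L\<^esub>)
               - of_nat t * of_nat (Z_count L t (m * ring.dim L K F) N \<zero>\<^bsub>L\<^esub>))
              / (of_nat q - of_nat t))"
proof -
  have cardL: "card (carrier L) = p ^ (e * m)" using assms(3,7) by (simp add: power_mult)
  interpret field L by (rule assms(5))
  interpret finite_field_generator L p "e * m" \<alpha>
    by unfold_locales (use assms(1,6,10) cardL in auto)
  define \<Delta> where "\<Delta> = Delta0 L p (e * m) \<alpha> N"
  define W where "W = {x. free_elem L N x}"
  let ?d = "ring.dim L K F"
  have N: "N dvd p ^ (e * m) - 1" using assms(3,11) by (simp add: power_mult)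
  have q1: "q > 1" unfolding assms(3) using prime_gt_1_nat[OF assms(1)] assms(2) by (rule one_less_power)
  have W: "W \<subseteq> carrier L" by (auto simp: W_def free_elem_def)
  have scaleF: "\<forall>c\<in>F - {\<zero>\<^bsub>L\<^esub>}. \<forall>x\<in>W. c \<otimes>\<^bsub>L\<^esub> x \<in> W"
  proof (intro ballI)
    fix c x assume c: "c \<in> F - {\<zero>\<^bsub>L\<^esub>}" and x: "x \<in> W"
    have "(q - 1) dvd p ^ (e * m) - 1"
    proof -
      have "int (q - 1) dvd int (q ^ m - 1)"
        using power_diff_1_eq[of "int q" m] q1 by (simp add: of_nat_diff)
      then show ?thesis using assms(3) by (simp add: power_mult flip: of_nat_dvd_iff)
    qed
    moreover have "c [^]\<^bsub>L\<^esub> q = c"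
      using c subfield_mem_iff[OF assms(8), of c] assms(9) by simp
    moreover have "r dvd (p ^ (e * m) - 1) div (q - 1)" if "prime r" "r dvd N" for r
      using assms(12)[OF that] assms(3) by (simp add: power_mult)
    ultimately show "c \<otimes>\<^bsub>L\<^esub> x \<in> W"
      using free_elem_mult_iff[OF N, of q c x] q1 c x W subfieldE(3)[OF assms(8)]
      by (auto simp: W_def)
  qed
  have Delta: "\<Delta> = (\<Sum>x\<in>W. canonical_char L p (e * m) x)"
    unfolding \<Delta>_def W_def by (rule Delta0_eq_sum_free[OF N])
  have Z: "Z_count L u k N c = card {x \<in> W. field_trace L u k x = c}" for u k c
    by (simp add: Z_count_def W_def)

  have finF: "finite F" using assms(8) subfieldE(3) finite_subset assms(6) by metis
  \<comment> \<open>The trace to \<open>K\<close> is a sum of \<open>m * dim K F\<close> conjugates; transitivity needs \<open>t\<close> as a power of \<open>p\<close>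
      whose exponent, multiplied by that number, gives \<open>e * m\<close>.\<close>
  have "q = t ^ ?d"
    using finite_subfield_dim[OF assms(13,8,14) finF] assms(9,15) by simp
  moreover have d0: "?d > 0" using calculation q1 by (cases "?d") auto
  ultimately have "t dvd p ^ e" using assms(3) by (metis dvd_power)
  then obtain s where s: "t = p ^ s" using divides_primepow_nat[OF assms(1)] by auto
  have "p ^ e = p ^ (s * ?d)" using \<open>q = t ^ ?d\<close> assms(3) by (simp add: s power_mult)
  then have e: "e = s * ?d" using prime_gt_1_nat[OF assms(1)] by simp
  then have "s > 0" using assms(2) by (cases s) auto
  have sk: "s * (m * ?d) = e * m" using e by simp

  have F1: "\<one>\<^bsub>L\<^esub> \<in> F - {\<zero>\<^bsub>L\<^esub>}" and K1: "\<one>\<^bsub>L\<^esub> \<in> K - {\<zero>\<^bsub>L\<^esub>}"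
    using subringE(3)[OF subfieldE(1)] assms(8,13) by auto
  have scaleK: "\<forall>c\<in>K - {\<zero>\<^bsub>L\<^esub>}. \<forall>x\<in>W. c \<otimes>\<^bsub>L\<^esub> x \<in> W"
    using scaleF assms(14) by blast
  have DK: "\<Delta> = of_nat (Z_count L t (m * ?d) N \<zero>\<^bsub>L\<^esub>) - of_nat (Z_count L t (m * ?d) N c)"
    if "c \<in> K - {\<zero>\<^bsub>L\<^esub>}" for c
    using sum_canonical_char_trace_fibres[OF assms(13) _ \<open>s > 0\<close> sk W scaleK that] assms(15) s
    by (simp add: Delta Z)
  have DF: "\<Delta> = of_nat (Z_count L q m N \<zero>\<^bsub>L\<^esub>) - of_nat (Z_count L q m N \<one>\<^bsub>L\<^esub>)"
    using sum_canonical_char_trace_fibres[OF assms(8) _ \<open>e > 0\<close> refl W scaleF F1] assms(9,3)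
    by (simp add: Delta Z)
  have WK: "(of_nat (card W) :: complex) = of_nat (Z_count L t (m * ?d) N \<zero>\<^bsub>L\<^esub>)
      + of_nat (Z_count L t (m * ?d) N \<one>\<^bsub>L\<^esub>) * (of_nat t - 1)"
    using card_trace_fibres[OF assms(13) _ sk W scaleK K1] assms(15) s by (simp add: Z)
  have WF: "(of_nat (card W) :: complex) = of_nat (Z_count L q m N \<zero>\<^bsub>L\<^esub>)
      + of_nat (Z_count L q m N \<one>\<^bsub>L\<^esub>) * (of_nat q - 1)"
    using card_trace_fibres[OF assms(8) _ refl W scaleF F1] assms(9,3) by (simp add: Z)
  \<comment> \<open>Both \<open>F\<close> and \<open>K\<close> satisfy \<open>card W = u Z(0) - (u - 1) \<Delta>\<close>, with \<open>u = q\<close> and \<open>u = t\<close>;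
      subtracting these two equations eliminates \<open>card W\<close>.\<close>
  have "of_nat (card W) = of_nat q * of_nat (Z_count L q m N \<zero>\<^bsub>L\<^esub>) - (of_nat q - 1) * \<Delta>"
    unfolding WF DF by (simp add: algebra_simps)
  moreover have "of_nat (card W) =
      of_nat t * of_nat (Z_count L t (m * ?d) N \<zero>\<^bsub>L\<^esub>) - (of_nat t - 1) * \<Delta>"
    unfolding WK DK[OF K1] by (simp add: algebra_simps)
  ultimately have "\<Delta> * (of_nat q - of_nat t) =
      of_nat q * of_nat (Z_count L q m N \<zero>\<^bsub>L\<^esub>)
      - of_nat t * of_nat (Z_count L t (m * ?d) N \<zero>\<^bsub>L\<^esub>)"
    by (simp add: algebra_simps)
  then have "t \<noteq> q \<longrightarrow> \<Delta> = (of_nat q * of_nat (Z_count L q m N \<zero>\<^bsub>L\<^esub>)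
      - of_nat t * of_nat (Z_count L t (m * ?d) N \<zero>\<^bsub>L\<^esub>)) / (of_nat q - of_nat t)"
    by (simp add: eq_divide_eq)
  then show ?thesis using DK unfolding \<Delta>_def by blast
qed

end
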